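(* Let $d,m$ be positive integers. Let $\mathbf{U}=(U_1,\ldots,U_m)\sim C^{\mathbf{U}}$ for an $m$-dimensional copula $C^{\mathbf{U}}$ with tail-dependence matrix $\Lambda$, and let $\mathbf{V}=(V_1,\ldots,V_d)\sim C^{\mathbf{V}}$ for a $d$-dimensional copula $C^{\mathbf{V}}$ with tail-dependence matrix $I_d$ (the identity matrix). Let $X=(X_{ij})_{d\times m}$ be a random matrix with values in $\{0,1\}^{d\times m}$ almost surely and with $\sum_{j=1}^m X_{ij}\le 1$ for every $i=1,\ldots,d$, and suppose that $X,\mathbf{U},\mathbf{V}$ are independent. Define $$\mathbf{Y}=X\mathbf{U}+\mathbf{Z}\circ\mathbf{V},\qquad \mathbf{Z}=(Z_1,\ldots,Z_d),\quad Z_i=1-\sum_{k=1}^m X_{ik},\ i=1,\ldots,d.$$ Then $\mathbf{Y}$ has tail-dependence matrix $\Gamma=\mathcal{L}(\mathbb{E}[X\Lambda X^\top])$.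
   Context: Vectors are column vectors and $\circ$ denotes the Hadamard (entrywise) product. For a square matrix $B$, $\mathcal{L}(B)$ is the matrix obtained from $B$ by replacing every diagonal entry by $1$ and keeping all off-diagonal entries. A $d$-dimensional copula is a distribution function on $[0,1]^d$ with uniform $\mathrm{U}[0,1]$ margins. The (lower) tail-dependence coefficient of two random variables $X_1\sim F_1$, $X_2\sim F_2$ with continuous distribution functions is $\lambda=\lim_{u\downarrow 0}\frac{1}{u}\mathbb{P}(F_1(X_1)\le u,\ F_2(X_2)\le u)$, given that the limit exists. The tail-dependence matrix of a random vector with continuous margins is the matrix of the pairwise tail-dependence coefficients of its components (all of these limits being assumed or asserted to exist); the tail-dependence matrix of a copula is that of a random vector distributed according to it. *)

theory Defs
  imports "HOL-Probability.Probability"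
begin

text \<open>The index types 'n, 'm, 'd (class finite, hence nonempty) play the role of the
  dimensions. On these vector types the order and the product are componentwise: \<open>{0..1}\<close> is
  the unit cube, \<open>{..u}\<close> is the lower orthant with corner \<open>u\<close>, and \<open>x * y\<close> is the
  Hadamard product.\<close>

text \<open>A function on the cube is represented by a function on the whole space whose values
  outside the cube are irrelevant.\<close>

definition cube_distribution :: "(real ^ 'n) measure \<Rightarrow> (real ^ 'n \<Rightarrow> real) \<Rightarrow> bool" where
  "cube_distribution P C \<longleftrightarrow>
     prob_space P \<and> sets P = sets borel \<and> measure P {0..1} = 1 \<and>
     (\<forall>u\<in>{0..1}. C u = measure P {..u})"

definition copula :: "(real ^ 'n \<Rightarrow> real) \<Rightarrow> bool" where
  "copula C \<longleftrightarrow>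
     (\<exists>P. cube_distribution P C \<and>
          (\<forall>i. distr P borel (\<lambda>x. x $ i) = uniform_measure lborel {0..1}))"

definition distributed_as :: "'a measure \<Rightarrow> ('a \<Rightarrow> real ^ 'n) \<Rightarrow> (real ^ 'n \<Rightarrow> real) \<Rightarrow> bool" where
  "distributed_as M W C \<longleftrightarrow> W \<in> borel_measurable M \<and> cube_distribution (distr M borel W) C"

definition has_tail_dependence_coeff ::
    "'a measure \<Rightarrow> ('a \<Rightarrow> real) \<Rightarrow> ('a \<Rightarrow> real) \<Rightarrow> real \<Rightarrow> bool" where
  "has_tail_dependence_coeff M X1 X2 l \<longleftrightarrow>
     (let F1 = cdf (distr M borel X1); F2 = cdf (distr M borel X2) in
       ((\<lambda>u. 1 / u * measure M {\<omega> \<in> space M. F1 (X1 \<omega>) \<le> u \<and> F2 (X2 \<omega>) \<le> u})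
          \<longlongrightarrow> l) (at_right 0))"

definition has_tail_dependence_matrix ::
    "'a measure \<Rightarrow> ('a \<Rightarrow> real ^ 'n) \<Rightarrow> real ^ 'n ^ 'n \<Rightarrow> bool" where
  "has_tail_dependence_matrix M W L \<longleftrightarrow>
     W \<in> borel_measurable M \<and>
     (\<forall>i. continuous_on UNIV (cdf (distr M borel (\<lambda>\<omega>. W \<omega> $ i)))) \<and>
     (\<forall>i j. has_tail_dependence_coeff M (\<lambda>\<omega>. W \<omega> $ i) (\<lambda>\<omega>. W \<omega> $ j) (L $ i $ j))"

text \<open>A law on the cube is determined by its distribution function, so the choice of \<open>P\<close> is
  unique and the identity on \<open>P\<close> is the canonical random vector distributed according to \<open>C\<close>.\<close>

definition copula_has_tail_dependence_matrix ::
    "(real ^ 'n \<Rightarrow> real) \<Rightarrow> real ^ 'n ^ 'n \<Rightarrow> bool" where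
  "copula_has_tail_dependence_matrix C L \<longleftrightarrow>
     (\<exists>P. cube_distribution P C \<and> has_tail_dependence_matrix P (\<lambda>x. x) L)"

definition one_diag :: "real ^ 'n ^ 'n \<Rightarrow> real ^ 'n ^ 'n" where
  "one_diag B = (\<chi> i j. if i = j then 1 else B $ i $ j)"

text \<open>Mutual independence of three random variables. The constant \<open>indep_vars\<close> requires a common
  value type, so its definition is unfolded here for three different ones.\<close>

definition indep_vars3 ::
    "'a measure \<Rightarrow> ('a \<Rightarrow> 'b::topological_space) \<Rightarrow> ('a \<Rightarrow> 'c::topological_space)
      \<Rightarrow> ('a \<Rightarrow> 'd::topological_space) \<Rightarrow> bool" where
  "indep_vars3 M X Y Z \<longleftrightarrow>
     X \<in> borel_measurable M \<and> Y \<in> borel_measurable M \<and> Z \<in> borel_measurable M \<and>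
     prob_space.indep_sets M
       (\<lambda>k::nat. [{X -` A \<inter> space M |A. A \<in> sets borel},
                  {Y -` A \<inter> space M |A. A \<in> sets borel},
                  {Z -` A \<inter> space M |A. A \<in> sets borel}] ! k) {0, 1, 2}"

end

theory Submission
  imports Defs
begin

text \<open>Almost surely each row of \<open>X\<close> is zero or a unit vector, so each \<open>Y\<^sub>i\<close> equals one of
  \<open>U\<^sub>1, \<dots>, U\<^sub>m, V\<^sub>i\<close>, and the choice is independent of \<open>U\<close> and \<open>V\<close>. Conditioning on the choices
  for \<open>i\<close> and \<open>j\<close> shows that \<open>Y\<^sub>i\<close> is again uniform, and writes \<open>\<P>(Y\<^sub>i \<le> u, Y\<^sub>j \<le> u) / u\<close> as a
  finite mixture of bivariate tail ratios. For \<open>i \<noteq> j\<close> the mixed \<open>U\<close>-\<open>V\<close> ratios equal \<open>u\<close> and the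
  \<open>V\<close>-\<open>V\<close> ratio has limit \<open>0\<close>, so that only the entries of \<open>\<Lambda>\<close> survive.\<close>

section \<open>Laws on the cube and their distribution functions\<close>

lemma borel_measurable_vec_nth [measurable (raw)]:
  assumes "f \<in> borel_measurable M"
  shows "(\<lambda>x. f x $ i) \<in> borel_measurable M"
proof -
  have "(\<lambda>v. v $ i) \<in> borel_measurable borel"
    by (intro borel_measurable_continuous_onI continuous_intros)
  then show ?thesis
    using assms by measurable
qed

text \<open>The values of \<open>C\<close> off the cube are arbitrary. As \<open>P\<close> is
  concentrated on the cube, capping the corner at \<open>1\<close> keeps the mass of the orthant,
  and an orthant whose corner has a negative coordinate misses the cube.\<close>

lemma cube_distribution_atMost:
  fixes P :: "(real ^ 'n) measure"
  assumes "cube_distribution P C"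
  shows "emeasure P {..u} = (if 0 \<le> u then ennreal (C (inf u 1)) else 0)"
proof -
  interpret prob_space P using assms by (simp add: cube_distribution_def)
  have sets: "sets P = sets borel" and cube: "prob {0..1} = 1"
    and C: "\<And>u. u \<in> {0..1} \<Longrightarrow> C u = prob {..u}"
    using assms by (auto simp: cube_distribution_def)
  have ev: "{..u} \<in> events" "{0..1} \<in> events" for u
    using sets by auto
  have AE: "AE x in P. x \<in> {0..1}"
    using cube ev prob_eq_1 by blast
  have "0 \<le> (1 :: real ^ 'n)"
    by (simp add: less_eq_vec_def)
  show ?thesis
  proof (cases "0 \<le> u")
    case True
    have "prob {..u} = prob {..inf u 1}"
      by (rule finite_measure_eq_AE) (use AE ev in auto)
    also have "\<dots> = C (inf u 1)"
      using True \<open>0 \<le> 1\<close> by (subst C) auto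
    finally show ?thesis
      using True by (simp add: emeasure_eq_measure)
  next
    case False
    have "prob {..u} = prob {}"
      by (rule finite_measure_eq_AE) (use AE ev False in \<open>auto intro: order_trans\<close>)
    then show ?thesis
      using False by (simp add: emeasure_eq_measure)
  qed
qed

text \<open>Lower orthants are an intersection-stable generator of the Borel sets. Since
  \<open>copula\<close> and \<open>copula_has_tail_dependence_matrix\<close> only assert that some
  law exists, uniqueness is what identifies their witnesses with the law of a given random
  vector.\<close>

lemma cube_distribution_unique:
  fixes P Q :: "(real ^ 'n) measure"
  assumes P: "cube_distribution P C" and Q: "cube_distribution Q C"
  shows "P = Q"
proof (rule measure_eqI_generator_eq[where E = "range atMost" and \<Omega> = UNIV
      and A = "\<lambda>i. {..(\<chi> _. real i)}"])
  interpret prob_space P using P by (simp add: cube_distribution_def)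
  show "Int_stable (range (atMost :: real ^ 'n \<Rightarrow> _))"
  proof (rule Int_stableI)
    fix a b :: "(real ^ 'n) set"
    assume "a \<in> range atMost" and "b \<in> range atMost"
    then obtain x y where "a = {..x}" and "b = {..y}"
      by auto
    then have "a \<inter> b = {..inf x y}"
      by auto
    then show "a \<inter> b \<in> range atMost"
      by blast
  qed
  show "sets P = sigma_sets UNIV (range atMost)" "sets Q = sigma_sets UNIV (range atMost)"
    using P Q by (auto simp: cube_distribution_def borel_eq_atMost)
  show "emeasure P X = emeasure Q X" if "X \<in> range atMost" for X
    using that cube_distribution_atMost[OF P] cube_distribution_atMost[OF Q] by auto
  show "(\<Union>i. {..(\<chi> _. real i) :: real ^ 'n}) = UNIV"
  proof (intro set_eqI iffI UNIV_I)
    fix x :: "real ^ 'n"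
    obtain n where "norm x \<le> real n"
      using real_arch_simple by blast
    then have "x \<le> (\<chi> _. real n)"
      by (simp add: less_eq_vec_def) (meson abs_ge_self component_le_norm_cart order_trans)
    then show "x \<in> (\<Union>i. {..(\<chi> _. real i)})"
      by blast
  qed
  show "emeasure P {..(\<chi> _. real i)} \<noteq> \<infinity>" for i
    by simp
qed auto

section \<open>Uniform margins and tail ratios\<close>

lemma cdf_uniform_unit_interval:
  "cdf (uniform_measure lborel {0..1 :: real}) t = max 0 (min 1 t)"
proof -
  have "{0..1} \<inter> {..t} = {0..min 1 t}"
    by auto
  then show ?thesis
    by (simp add: cdf_def measure_uniform_measure)
qed

lemma distributed_as_copula_cdf:
  fixes W :: "'a \<Rightarrow> real ^ 'n"
  assumes "distributed_as M W C" and "copula C"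
  shows "cdf (distr M borel (\<lambda>\<omega>. W \<omega> $ k)) t = max 0 (min 1 t)"
proof -
  have W: "W \<in> borel_measurable M" and D: "cube_distribution (distr M borel W) C"
    using assms by (auto simp: distributed_as_def)
  obtain P where P: "cube_distribution P C"
    and marg: "\<And>i. distr P borel (\<lambda>x. x $ i) = uniform_measure lborel {0..1}"
    using assms by (auto simp: copula_def)
  have "distr M borel (\<lambda>\<omega>. W \<omega> $ k) = distr (distr M borel W) borel (\<lambda>x. x $ k)"
    using W by (subst distr_distr) (auto simp: comp_def)
  also have "\<dots> = uniform_measure lborel {0..1}"
    using marg cube_distribution_unique[OF D P] by simp
  finally show ?thesis
    by (simp add: cdf_uniform_unit_interval)
qed

lemma distributed_as_copula_prob:
  fixes W :: "'a \<Rightarrow> real ^ 'n"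
  assumes "distributed_as M W C" and "copula C"
  shows "measure M {\<omega> \<in> space M. W \<omega> $ k \<le> t} = max 0 (min 1 t)"
proof -
  have [measurable]: "W \<in> borel_measurable M"
    using assms by (auto simp: distributed_as_def)
  have "(\<lambda>\<omega>. W \<omega> $ k) \<in> borel_measurable M"
    by measurable
  then show ?thesis
    using distributed_as_copula_cdf[OF assms, of k t]
    by (simp add: cdf_def measure_distr vimage_def Int_def conj_commute)
qed

text \<open>For \<open>0 < u < 1\<close>, clamping a value to the unit interval does not affect its
  comparison with \<open>u\<close>, so the distribution functions drop out of the ratio near
  \<open>0\<close>.\<close>

lemma has_tail_dependence_coeff_uniform_iff:
  assumes "\<And>t. cdf (distr M borel X1) t = max 0 (min 1 t)"
    and "\<And>t. cdf (distr M borel X2) t = max 0 (min 1 t)"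
  shows "has_tail_dependence_coeff M X1 X2 l \<longleftrightarrow>
    ((\<lambda>u. 1 / u * measure M {\<omega> \<in> space M. X1 \<omega> \<le> u \<and> X2 \<omega> \<le> u}) \<longlongrightarrow> l) (at_right 0)"
proof -
  have "\<forall>\<^sub>F u in at_right 0. u \<in> {0<..<1 :: real}"
    by (rule eventually_at_right_real) simp
  then show ?thesis
    unfolding has_tail_dependence_coeff_def Let_def assms
    by (intro tendsto_cong, elim eventually_mono)
      (auto intro!: arg_cong[where f = "measure M"])
qed

text \<open>The hypothesis on \<open>C\<close> concerns the identity under some law
  \<open>P\<close>; this law must be that of \<open>W\<close>, so the limits carry over to
  \<open>W\<close>.\<close>

lemma copula_tail_dependence_tendsto:
  fixes W :: "'a \<Rightarrow> real ^ 'n"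
  assumes "distributed_as M W C" and "copula C" and "copula_has_tail_dependence_matrix C L"
  shows "((\<lambda>u. 1 / u * measure M {\<omega> \<in> space M. W \<omega> $ k \<le> u \<and> W \<omega> $ l \<le> u})
    \<longlongrightarrow> L $ k $ l) (at_right 0)"
proof -
  have W [measurable]: "W \<in> borel_measurable M" and D: "cube_distribution (distr M borel W) C"
    using assms by (auto simp: distributed_as_def)
  obtain P where "cube_distribution P C" and "has_tail_dependence_matrix P (\<lambda>x. x) L"
    using assms by (auto simp: copula_has_tail_dependence_matrix_def)
  with cube_distribution_unique[OF D] have
    "has_tail_dependence_coeff (distr M borel W) (\<lambda>x. x $ k) (\<lambda>x. x $ l) (L $ k $ l)"
    by (auto simp: has_tail_dependence_matrix_def)
  moreover have "distr (distr M borel W) borel (\<lambda>x. x $ i) = distr M borel (\<lambda>\<omega>. W \<omega> $ i)" for i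
    by (subst distr_distr) (auto simp: comp_def)
  ultimately show ?thesis
    by (subst (asm) has_tail_dependence_coeff_uniform_iff)
      (auto simp: distributed_as_copula_cdf[OF assms(1,2)] measure_distr vimage_def Int_def
        conj_ac)
qed

section \<open>Independence\<close>

lemma indep_vars3_prob:
  assumes "prob_space M" and "indep_vars3 M X Y Z"
    and "A \<in> sets borel" and "B \<in> sets borel" and "C \<in> sets borel"
  shows "measure M {\<omega> \<in> space M. X \<omega> \<in> A \<and> Y \<omega> \<in> B \<and> Z \<omega> \<in> C} =
    measure M {\<omega> \<in> space M. X \<omega> \<in> A} * measure M {\<omega> \<in> space M. Y \<omega> \<in> B} *
    measure M {\<omega> \<in> space M. Z \<omega> \<in> C}"
proof -
  interpret prob_space M by fact
  let ?E = "\<lambda>k::nat. [X -` A \<inter> space M, Y -` B \<inter> space M, Z -` C \<inter> space M] ! k"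
  have "prob (\<Inter>k\<in>{0, 1, 2}. ?E k) = (\<Prod>k\<in>{0, 1, 2}. prob (?E k))"
  proof (rule indep_setsD)
    show "indep_sets (\<lambda>k. [{X -` A \<inter> space M |A. A \<in> sets borel},
      {Y -` A \<inter> space M |A. A \<in> sets borel}, {Z -` A \<inter> space M |A. A \<in> sets borel}] ! k) {0, 1, 2}"
      using assms by (simp add: indep_vars3_def)
  qed (use assms in auto)
  moreover have "(\<Inter>k\<in>{0, 1, 2}. ?E k) = {\<omega> \<in> space M. X \<omega> \<in> A \<and> Y \<omega> \<in> B \<and> Z \<omega> \<in> C}"
    by auto
  ultimately show ?thesis
    by (simp add: vimage_def Int_def conj_commute mult.assoc)
qed

section \<open>Coordinates, rows and unit vectors\<close>

lemma borel_measurable_vecI: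
  fixes f :: "'a \<Rightarrow> real ^ 'n"
  assumes "\<And>i. (\<lambda>x. f x $ i) \<in> borel_measurable M"
  shows "f \<in> borel_measurable M"
  using assms
  by (subst borel_measurable_euclidean_space) (auto simp: Basis_vec_def inner_axis)

text \<open>Only rows \<open>i\<close> and \<open>j\<close> of \<open>A\<close> enter this entry, so
  it takes finitely many values once both rows are selectors.\<close>

lemma matrix_sandwich_nth:
  fixes A :: "real ^ 'm ^ 'd" and B :: "real ^ 'm ^ 'm"
  shows "(A ** B ** transpose A) $ i $ j = A $ i \<bullet> (B *v A $ j)"
proof -
  have "(A ** B ** transpose A) $ i $ j = (\<Sum>l\<in>UNIV. \<Sum>k\<in>UNIV. A $ i $ k * B $ k $ l * A $ j $ l)"
    by (simp add: matrix_matrix_mult_def transpose_def sum_distrib_right)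
  also have "\<dots> = (\<Sum>k\<in>UNIV. \<Sum>l\<in>UNIV. A $ i $ k * B $ k $ l * A $ j $ l)"
    by (rule sum.swap)
  also have "\<dots> = A $ i \<bullet> (B *v A $ j)"
    by (simp add: inner_vec_def matrix_vector_mult_def sum_distrib_left mult.assoc)
  finally show ?thesis .
qed

text \<open>Encodes the choice made by a row: \<open>None\<close> picks the coordinate of
  \<open>V\<close>, \<open>Some k\<close> picks coordinate \<open>k\<close> of \<open>U\<close>. As
  \<open>'m option\<close> is finite, conditioning on a row becomes a sum over
  \<open>UNIV\<close>.\<close>

definition selector :: "'m option \<Rightarrow> real ^ 'm" where
  "selector s = (case s of None \<Rightarrow> 0 | Some k \<Rightarrow> axis k 1)"

lemma selector_simps [simp]:
  "selector None = 0" "selector (Some k) = axis k 1"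
  by (simp_all add: selector_def)

lemma selector_eq_iff [simp]: "selector s = selector t \<longleftrightarrow> s = t"
  by (cases s; cases t) (auto simp: axis_eq_axis axis_eq_0_iff eq_commute[of 0])

lemma norm_selector_le: "norm (selector s) \<le> 1"
  by (cases s) auto

text \<open>A second entry \<open>1\<close> would push the row sum to at least \<open>2\<close>.
  Uniqueness of \<open>s\<close> later makes the conditioning events disjoint.\<close>

lemma zero_one_row_selector:
  fixes r :: "real ^ 'm"
  assumes "\<forall>k. r $ k \<in> {0, 1}" and "(\<Sum>k\<in>UNIV. r $ k) \<le> 1"
  shows "\<exists>!s. r = selector s"
proof (cases "r = 0")
  case True
  then show ?thesis
    by (intro ex1I[of _ None]) (auto simp flip: selector_simps(1))
next
  case False
  then obtain k where k: "r $ k = 1"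
    using assms(1) by (fastforce simp: vec_eq_iff)
  have "r $ l = 0" if "l \<noteq> k" for l
  proof -
    have "r $ l + r $ k = (\<Sum>j\<in>{l, k}. r $ j)"
      using that by simp
    also have "\<dots> \<le> (\<Sum>j\<in>UNIV. r $ j)"
    proof (rule sum_mono2)
      show "0 \<le> r $ b" for b
        using assms(1)[rule_format, of b] by auto
    qed auto
    finally show ?thesis
      using k assms(1)[rule_format, of l] assms(2) by auto
  qed
  with k have "r = selector (Some k)"
    by (auto simp: vec_eq_iff axis_def)
  then show ?thesis
    by (metis selector_eq_iff)
qed

section \<open>Conditioning on the rows of \<open>X\<close>\<close>

theorem theorem4p2:
  fixes M :: "'a measure"
    and U :: "'a \<Rightarrow> real ^ 'm" and V Y Z :: "'a \<Rightarrow> real ^ 'd"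
    and X :: "'a \<Rightarrow> real ^ 'm ^ 'd"
    and CU :: "real ^ 'm \<Rightarrow> real" and CV :: "real ^ 'd \<Rightarrow> real"
    and \<Lambda> :: "real ^ 'm ^ 'm"
  assumes "prob_space M"
    and "copula CU" and "copula_has_tail_dependence_matrix CU \<Lambda>"
    and "distributed_as M U CU"
    and "copula CV" and "copula_has_tail_dependence_matrix CV (mat 1)"
    and "distributed_as M V CV"
    and "X \<in> borel_measurable M"
    and "AE \<omega> in M. \<forall>i j. X \<omega> $ i $ j \<in> {0, 1}"
    and "AE \<omega> in M. \<forall>i. (\<Sum>j\<in>UNIV. X \<omega> $ i $ j) \<le> 1"
    and "indep_vars3 M X U V"
    and "\<And>\<omega>. Z \<omega> = (\<chi> i. 1 - (\<Sum>k\<in>UNIV. X \<omega> $ i $ k))"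
    and "\<And>\<omega>. Y \<omega> = X \<omega> *v U \<omega> + Z \<omega> * V \<omega>"
  shows "has_tail_dependence_matrix M Y
           (one_diag (prob_space.expectation M (\<lambda>\<omega>. X \<omega> ** \<Lambda> ** transpose (X \<omega>))))"
proof -
  interpret prob_space M by fact
  \<comment> \<open>\<open>W i s\<close> is the value of coordinate \<open>i\<close> of
    \<open>Y\<close> when row \<open>i\<close> of \<open>X\<close> is \<open>selector s\<close>.
    \<open>L s t\<close> is the tail coefficient of two such choices in distinct rows: an entry of
    \<open>\<Lambda>\<close>, or \<open>0\<close> if \<open>None\<close> occurs.\<close>
  define W where "W i s \<omega> = (case s of None \<Rightarrow> V \<omega> $ i | Some k \<Rightarrow> U \<omega> $ k)" for i s \<omega>
  define L where "L s t = selector s \<bullet> (\<Lambda> *v selector t)" for s t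

  have [measurable]: "X \<in> borel_measurable M" "U \<in> borel_measurable M" "V \<in> borel_measurable M"
    using assms by (auto simp: distributed_as_def)
  have Y_nth: "Y \<omega> $ i = X \<omega> $ i \<bullet> U \<omega> + (1 - (\<Sum>k\<in>UNIV. X \<omega> $ i $ k)) * V \<omega> $ i" for \<omega> i
    using assms(12,13) by (simp add: matrix_vector_mul_component)
  have Y_eq: "Y \<omega> $ i = W i s \<omega>" if "X \<omega> $ i = selector s" for \<omega> i s
  proof (cases s)
    case (Some l)
    \<comment> \<open>The row sum is \<open>1\<close>, so the factor of \<open>V\<close>
      vanishes.\<close>
    have "(\<Sum>k\<in>UNIV. axis l (1 :: real) $ k) = 1"
      by (simp add: axis_def)
    then show ?thesis
      using that Some by (simp add: Y_nth W_def inner_axis')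
  qed (use that in \<open>simp add: Y_nth W_def\<close>)
  have Y_meas [measurable]: "Y \<in> borel_measurable M"
    by (rule borel_measurable_vecI) (simp add: Y_nth)
  have W_meas [measurable]: "W i s \<in> borel_measurable M" for i s
    by (cases s) (simp_all add: W_def[abs_def])
  have sel: "AE \<omega> in M. \<forall>i. \<exists>!s. X \<omega> $ i = selector s"
    using assms(9,10) by eventually_elim (simp add: zero_one_row_selector)

  have indep: "prob {\<omega> \<in> space M. X \<omega> \<in> A \<and> U \<omega> \<in> B \<and> V \<omega> \<in> C} =
      prob {\<omega> \<in> space M. X \<omega> \<in> A} * prob {\<omega> \<in> space M. U \<omega> \<in> B} * prob {\<omega> \<in> space M. V \<omega> \<in> C}"
    if "A \<in> sets borel" "B \<in> sets borel" "C \<in> sets borel" for A B C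
    using assms(1,11) that by (rule indep_vars3_prob)
  have indep_X: "prob {\<omega> \<in> space M. X \<omega> \<in> A \<and> W i s \<omega> \<le> u \<and> W j t \<omega> \<le> u} =
      prob {\<omega> \<in> space M. X \<omega> \<in> A} * prob {\<omega> \<in> space M. W i s \<omega> \<le> u \<and> W j t \<omega> \<le> u}"
    if A: "A \<in> sets borel" for A i j s t u
  proof -
    \<comment> \<open>Each event on \<open>W\<close> splits into a condition on \<open>U\<close> and
      one on \<open>V\<close>, with \<open>UNIV\<close> for the vector that is not selected. The
      product formula is then used for \<open>A\<close> and for \<open>UNIV\<close> in its place,
      and the two are compared.\<close>
    define H where "H r = (case r of None \<Rightarrow> UNIV | Some k \<Rightarrow> {x :: real ^ 'm. x $ k \<le> u})" for r
    define K where "K i r = (case r of None \<Rightarrow> {x :: real ^ 'd. x $ i \<le> u} | Some (k :: 'm) \<Rightarrow> UNIV)"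
      for i r
    have W_iff: "W i r \<omega> \<le> u \<longleftrightarrow> U \<omega> \<in> H r \<and> V \<omega> \<in> K i r" for i r \<omega>
      by (cases r) (auto simp: W_def H_def K_def)
    have H: "H s \<inter> H t \<in> sets borel"
      by (cases s; cases t) (auto simp: H_def)
    have K: "K i s \<inter> K j t \<in> sets borel"
      by (cases s; cases t) (auto simp: K_def)
    have "(W i s \<omega> \<le> u \<and> W j t \<omega> \<le> u) \<longleftrightarrow> U \<omega> \<in> H s \<inter> H t \<and> V \<omega> \<in> K i s \<inter> K j t" for \<omega>
      by (auto simp: W_iff)
    then show ?thesis
      using indep[OF A H K] indep[OF _ H K, of UNIV] by (simp add: prob_space)
  qed

  have W_prob: "prob {\<omega> \<in> space M. W i s \<omega> \<le> t} = max 0 (min 1 t)" for i s t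
    using distributed_as_copula_prob[OF assms(4,2)] distributed_as_copula_prob[OF assms(7,5)]
    by (cases s) (simp_all add: W_def)

  \<comment> \<open>Uniform margins of \<open>Y\<close>\<close>
  have Y_prob: "prob {\<omega> \<in> space M. Y \<omega> $ i \<le> t} = max 0 (min 1 t)" for i t
  proof -
    let ?p = "\<lambda>s. prob {\<omega> \<in> space M. X \<omega> \<in> {x. x $ i = selector s}}"
    have "prob {\<omega> \<in> space M. True} = (\<Sum>s\<in>UNIV. ?p s)"
      by (rule prob_sum) (use sel in auto)
    then have total: "(\<Sum>s\<in>UNIV. ?p s) = 1"
      by (simp add: prob_space)
    \<comment> \<open>The condition on \<open>W\<close> is repeated so that \<open>indep_X\<close>
      applies with both choices equal.\<close>
    have "prob {\<omega> \<in> space M. Y \<omega> $ i \<le> t} =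
        (\<Sum>s\<in>UNIV. prob {\<omega> \<in> space M. X \<omega> \<in> {x. x $ i = selector s} \<and> W i s \<omega> \<le> t \<and> W i s \<omega> \<le> t})"
    proof (rule prob_sum)
      show "AE \<omega> in M.
          (\<forall>s\<in>UNIV. X \<omega> \<in> {x. x $ i = selector s} \<and> W i s \<omega> \<le> t \<and> W i s \<omega> \<le> t \<longrightarrow> Y \<omega> $ i \<le> t) \<and>
          (Y \<omega> $ i \<le> t \<longrightarrow>
            (\<exists>!s\<in>UNIV. X \<omega> \<in> {x. x $ i = selector s} \<and> W i s \<omega> \<le> t \<and> W i s \<omega> \<le> t))"
        using sel
      proof eventually_elim
        case (elim \<omega>)
        obtain s where s: "X \<omega> $ i = selector s"
          using elim by metis
        show ?case
          using s by (auto simp: Y_eq[OF s])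
      qed
    qed auto
    also have "\<dots> = (\<Sum>s\<in>UNIV. ?p s * max 0 (min 1 t))"
      by (subst indep_X) (simp_all add: W_prob)
    also have "\<dots> = max 0 (min 1 t)"
      using total by (simp flip: sum_distrib_right)
    finally show ?thesis .
  qed
  have Y_cdf: "cdf (distr M borel (\<lambda>\<omega>. Y \<omega> $ i)) t = max 0 (min 1 t)" for i t
  proof -
    have "(\<lambda>\<omega>. Y \<omega> $ i) \<in> borel_measurable M"
      by measurable
    then show ?thesis
      using Y_prob[of i t] by (simp add: cdf_def measure_distr vimage_def Int_def conj_commute)
  qed

  \<comment> \<open>The joint law of the choices in rows \<open>i\<close> and \<open>j\<close>,
    giving the weights both of the mixture and of the expected matrix.\<close>
  let ?q = "\<lambda>i j (s, t). prob {\<omega> \<in> space M. X \<omega> \<in> {x. x $ i = selector s \<and> x $ j = selector t}}"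
  have Y_joint: "prob {\<omega> \<in> space M. Y \<omega> $ i \<le> u \<and> Y \<omega> $ j \<le> u} =
      (\<Sum>(s, t)\<in>UNIV. ?q i j (s, t) * prob {\<omega> \<in> space M. W i s \<omega> \<le> u \<and> W j t \<omega> \<le> u})" for i j u
  proof -
    have "prob {\<omega> \<in> space M. Y \<omega> $ i \<le> u \<and> Y \<omega> $ j \<le> u} =
        (\<Sum>p\<in>UNIV. prob {\<omega> \<in> space M. X \<omega> \<in> {x. x $ i = selector (fst p) \<and> x $ j = selector (snd p)} \<and>
          W i (fst p) \<omega> \<le> u \<and> W j (snd p) \<omega> \<le> u})"
    proof (rule prob_sum)
      show "AE \<omega> in M.
          (\<forall>p\<in>UNIV. X \<omega> \<in> {x. x $ i = selector (fst p) \<and> x $ j = selector (snd p)} \<and>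
            W i (fst p) \<omega> \<le> u \<and> W j (snd p) \<omega> \<le> u \<longrightarrow> Y \<omega> $ i \<le> u \<and> Y \<omega> $ j \<le> u) \<and>
          (Y \<omega> $ i \<le> u \<and> Y \<omega> $ j \<le> u \<longrightarrow>
            (\<exists>!p\<in>UNIV. X \<omega> \<in> {x. x $ i = selector (fst p) \<and> x $ j = selector (snd p)} \<and>
              W i (fst p) \<omega> \<le> u \<and> W j (snd p) \<omega> \<le> u))"
        using sel
      proof eventually_elim
        case (elim \<omega>)
        obtain s t where st: "X \<omega> $ i = selector s" "X \<omega> $ j = selector t"
          using elim by metis
        show ?case
          using st by (auto simp: Y_eq[OF st(1)] Y_eq[OF st(2)] intro!: ex1I[of _ "(s, t)"])
      qed
    qed auto
    then show ?thesis
      by (subst (asm) indep_X) (simp_all add: case_prod_beta)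
  qed

  \<comment> \<open>Limits of the conditional tail ratios\<close>
  have W_tendsto: "((\<lambda>u. 1 / u * prob {\<omega> \<in> space M. W i s \<omega> \<le> u \<and> W j t \<omega> \<le> u}) \<longlongrightarrow> L s t)
      (at_right 0)" if "i \<noteq> j" for i j s t
  proof -
    have mixed: "((\<lambda>u. 1 / u * prob {\<omega> \<in> space M. U \<omega> $ k \<le> u \<and> V \<omega> $ l \<le> u}) \<longlongrightarrow> 0) (at_right 0)"
      for k l
    proof (rule tendsto_cong[THEN iffD1])
      \<comment> \<open>By independence the ratio is \<open>u * u / u = u\<close> for
        \<open>0 < u < 1\<close>.\<close>
      have "prob {\<omega> \<in> space M. U \<omega> $ k \<le> u \<and> V \<omega> $ l \<le> u} = max 0 (min 1 u) * max 0 (min 1 u)" for u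
        using indep[of UNIV "{x. x $ k \<le> u}" "{x. x $ l \<le> u}"]
          distributed_as_copula_prob[OF assms(4,2)] distributed_as_copula_prob[OF assms(7,5)]
        by (simp add: prob_space)
      then show "\<forall>\<^sub>F u in at_right 0. u = 1 / u * prob {\<omega> \<in> space M. U \<omega> $ k \<le> u \<and> V \<omega> $ l \<le> u}"
        by (intro eventually_mono[OF eventually_at_right_real[of 0 1]]) auto
    qed (rule tendsto_ident_at)
    show ?thesis
      \<comment> \<open>The condition \<open>i \<noteq> j\<close> enters when both choices are
        \<open>None\<close>: the limit is then an off-diagonal entry of \<open>mat 1\<close>. Two
        rows may choose the same coordinate of \<open>U\<close>, which gives a diagonal entry of
        \<open>\<Lambda>\<close>.\<close>
      using copula_tail_dependence_tendsto[OF assms(4,2,3)] mixed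
        copula_tail_dependence_tendsto[OF assms(7,5,6), of i j] that
      by (cases s; cases t)
        (auto simp: W_def L_def inner_axis' matrix_vector_mult_basis column_def mat_def conj_commute)
  qed

  \<comment> \<open>Entries of the expected matrix\<close>
  have expect: "expectation (\<lambda>\<omega>. X \<omega> ** \<Lambda> ** transpose (X \<omega>)) $ i $ j =
      (\<Sum>(s, t)\<in>UNIV. ?q i j (s, t) * L s t)" for i j
  proof -
    let ?f = "\<lambda>x :: real ^ 'm ^ 'd. x ** \<Lambda> ** transpose x"
    have cont: "continuous_on UNIV ?f"
      unfolding matrix_matrix_mult_def transpose_def by (intro continuous_intros)
    \<comment> \<open>Rows have norm at most \<open>1\<close> almost surely, so \<open>X\<close>
      stays in this ball, on which the continuous \<open>?f\<close> is bounded. The resulting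
      integrability allows entries to be taken inside the expectation.\<close>
    have "bounded (?f ` cball 0 (real CARD('d)))"
      by (intro compact_imp_bounded compact_continuous_image continuous_on_subset[OF cont]) auto
    then obtain b where "\<forall>y\<in>?f ` cball 0 (real CARD('d)). norm y \<le> b"
      unfolding bounded_iff by blast
    then have b: "norm (?f x) \<le> b" if "norm x \<le> real CARD('d)" for x
      using that by simp
    have int: "integrable M (\<lambda>\<omega>. ?f (X \<omega>))"
    proof (rule integrable_const_bound)
      show "AE \<omega> in M. norm (?f (X \<omega>)) \<le> b"
        using sel
      proof eventually_elim
        case (elim \<omega>)
        have "norm (X \<omega> $ i) \<le> 1" for i
          using elim norm_selector_le by metis
        then have "(\<Sum>i\<in>UNIV. norm (X \<omega> $ i)) \<le> (\<Sum>i\<in>(UNIV :: 'd set). 1)"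
          by (intro sum_mono)
        moreover have "norm (X \<omega>) \<le> (\<Sum>i\<in>UNIV. norm (X \<omega> $ i))"
          unfolding norm_vec_def by (rule L2_set_le_sum) simp
        ultimately show ?case
          by (intro b) simp
      qed
      show "(\<lambda>\<omega>. ?f (X \<omega>)) \<in> borel_measurable M"
        using borel_measurable_continuous_onI[OF cont] by measurable
    qed
    have "bounded_linear (\<lambda>x :: real ^ 'd ^ 'd. x $ i $ j)"
      by (intro bounded_linear_compose[OF bounded_linear_vec_nth bounded_linear_vec_nth])
    then have "expectation (\<lambda>\<omega>. ?f (X \<omega>)) $ i $ j = expectation (\<lambda>\<omega>. ?f (X \<omega>) $ i $ j)"
      using int by (rule integral_bounded_linear[symmetric])
    also have "\<dots> = expectation (\<lambda>\<omega>. \<Sum>(s, t)\<in>UNIV.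
        indicator {\<omega> \<in> space M. X \<omega> \<in> {x. x $ i = selector s \<and> x $ j = selector t}} \<omega> * L s t)"
    proof (rule integral_cong_AE)
      show "(\<lambda>\<omega>. ?f (X \<omega>) $ i $ j) \<in> borel_measurable M"
        using borel_measurable_integrable[OF int] by measurable
      show "AE \<omega> in M. ?f (X \<omega>) $ i $ j = (\<Sum>(s, t)\<in>UNIV.
          indicator {\<omega> \<in> space M. X \<omega> \<in> {x. x $ i = selector s \<and> x $ j = selector t}} \<omega> * L s t)"
        using sel AE_space
      proof eventually_elim
        case (elim \<omega>)
        obtain s t where st: "X \<omega> $ i = selector s" "X \<omega> $ j = selector t"
          using elim by metis
        \<comment> \<open>By injectivity of \<open>selector\<close>, only the pair of choices
          actually made has a nonzero indicator.\<close>
        then have "(\<Sum>(s, t)\<in>UNIV.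
          indicator {\<omega> \<in> space M. X \<omega> \<in> {x. x $ i = selector s \<and> x $ j = selector t}} \<omega> * L s t) =
          (\<Sum>p\<in>UNIV. if p = (s, t) then L s t else 0)"
          using elim by (intro sum.cong) (auto simp: indicator_def)
        with st show ?case
          by (simp add: matrix_sandwich_nth L_def)
      qed
    qed (unfold case_prod_beta, measurable)
    also have "\<dots> = (\<Sum>(s, t)\<in>UNIV. ?q i j (s, t) * L s t)"
      by (subst Bochner_Integration.integral_sum) (auto simp: case_prod_beta less_top[symmetric])
    finally show ?thesis .
  qed

  have "has_tail_dependence_coeff M (\<lambda>\<omega>. Y \<omega> $ i) (\<lambda>\<omega>. Y \<omega> $ j)
      (one_diag (expectation (\<lambda>\<omega>. X \<omega> ** \<Lambda> ** transpose (X \<omega>))) $ i $ j)" for i j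
    unfolding has_tail_dependence_coeff_uniform_iff[OF Y_cdf Y_cdf]
  proof (cases "i = j")
    case True
    \<comment> \<open>The ratio is exactly \<open>1\<close> for \<open>0 < u < 1\<close>. The
      mixture formula with \<open>L\<close> would fail here, since \<open>L None None\<close> is
      \<open>0\<close> while a coordinate of \<open>V\<close> paired with itself has coefficient
      \<open>1\<close>; hence \<open>one_diag\<close>.\<close>
    have "\<forall>\<^sub>F u in at_right 0. 1 = 1 / u * prob {\<omega> \<in> space M. Y \<omega> $ i \<le> u \<and> Y \<omega> $ j \<le> u}"
      using True
      by (intro eventually_mono[OF eventually_at_right_real[of 0 1]]) (auto simp: Y_prob)
    then show "((\<lambda>u. 1 / u * prob {\<omega> \<in> space M. Y \<omega> $ i \<le> u \<and> Y \<omega> $ j \<le> u}) \<longlongrightarrow>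
        one_diag (expectation (\<lambda>\<omega>. X \<omega> ** \<Lambda> ** transpose (X \<omega>))) $ i $ j) (at_right 0)"
      using True by (subst tendsto_cong[symmetric]) (auto simp: one_diag_def)
  next
    case False
    \<comment> \<open>The weights do not depend on \<open>u\<close> and the sum is finite, so the
      limit is taken termwise.\<close>
    have "((\<lambda>u. \<Sum>(s, t)\<in>UNIV. ?q i j (s, t) *
        (1 / u * prob {\<omega> \<in> space M. W i s \<omega> \<le> u \<and> W j t \<omega> \<le> u})) \<longlongrightarrow>
        (\<Sum>(s, t)\<in>UNIV. ?q i j (s, t) * L s t)) (at_right 0)"
      unfolding case_prod_beta by (intro tendsto_intros W_tendsto False)
    then show "((\<lambda>u. 1 / u * prob {\<omega> \<in> space M. Y \<omega> $ i \<le> u \<and> Y \<omega> $ j \<le> u}) \<longlongrightarrow>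
        one_diag (expectation (\<lambda>\<omega>. X \<omega> ** \<Lambda> ** transpose (X \<omega>))) $ i $ j) (at_right 0)"
      using False
      by (simp add: Y_joint expect one_diag_def case_prod_beta sum_distrib_left mult.left_commute)
  qed
  moreover have "continuous_on UNIV (cdf (distr M borel (\<lambda>\<omega>. Y \<omega> $ i)))" for i
    unfolding Y_cdf by (intro continuous_intros)
  ultimately show ?thesis
    using Y_meas by (simp add: has_tail_dependence_matrix_def)
qed

end
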